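(* Let $\alpha,\beta>-1$. The Laguerre weight $w_\alpha(x)=e^{-x}x^\alpha$ on $(0,\infty)$ is a Darboux transformation of the Laguerre weight $w_\beta(x)=e^{-x}x^\beta$ on $(0,\infty)$ if and only if $\alpha-\beta\in\mathbb Z$.
   Context: Differential operators $D=\sum_{j}\partial^jf_j(x)$ with $f_j\in\mathbb C[x]$, $\partial=\frac{d}{dx}$, act on the right on functions: $p(x)\cdot D=\sum_j p^{(j)}(x)f_j(x)$; products satisfy $p\cdot(D_1D_2)=(p\cdot D_1)\cdot D_2$. The algebra of these operators is denoted $\Omega[x]$. For a scalar weight $w$ on an interval (positive almost everywhere, smooth, with finite moments) with monic orthogonal polynomials $p_n$, $\mathcal D(w)$ is the algebra of all $D\in\Omega[x]$ such that for every $n\ge 0$, $p_n\cdot D=\Lambda_n(D)p_n$ for some $\Lambda_n(D)\in\mathbb C$. An operator $\mathcal V\in\Omega[x]$ is degree-preserving if $\deg(p\cdot\mathcal V)=\deg p$ for all $p\in\mathbb C[x]$. For scalar weights $w,\widetilde w$ on the same interval with monic orthogonal polynomials $p_n,\widetilde p_n$, $\widetilde w$ is a Darboux transformation of $w$ if there is $D\in\mathcal D(w)$ with $D=\mathcal V\mathcal N$, where $\mathcal V,\mathcal N\in\Omega[x]$ are degree-preserving and $p_n\cdot\mathcal V=A_n\widetilde p_n$ for all $n\in\mathbb N_0$, for some $A_n\in\mathbb C$. *)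

theory Defs
  imports "HOL-Analysis.Analysis" "HOL-Computational_Algebra.Polynomial"
begin

section \<open>Differential operators with polynomial coefficients\<close>

text \<open>
  The operator \<open>\<Sum>j. \<partial>^j f\<^sub>j(x)\<close> is stored as the finitely supported family of its
  coefficients, \<open>coeff D j = f\<^sub>j\<close>.  Addition is that of \<^typ>\<open>complex poly poly\<close>, but the
  product is \<open>dop_mult\<close> below and not the commutative product of that type.
\<close>

type_synonym diff_op = "complex poly poly"

text \<open>The right action \<open>p \<cdot> D = \<Sum>j. p^(j) f\<^sub>j\<close>.\<close>

definition dop_act :: "complex poly \<Rightarrow> diff_op \<Rightarrow> complex poly"  (infixl \<open>\<bullet>\<^sub>d\<close> 70) where
  "p \<bullet>\<^sub>d D = (\<Sum>j\<le>degree D. (pderiv ^^ j) p * coeff D j)"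

text \<open>
  Since operators act on the right, the Leibniz rule gives
  \<open>(\<partial>^i f)(\<partial>^j g) = \<Sum>k\<le>j. (j choose k) \<partial>^(i+k) f^(j-k) g\<close>.
  Lemmas \<open>dop_act_mult\<close> and \<open>dop_act_faithful\<close> show that this is the product determined
  by the action.
\<close>

definition dop_mult :: "diff_op \<Rightarrow> diff_op \<Rightarrow> diff_op"  (infixl \<open>\<odot>\<close> 70) where
  "D \<odot> E = (\<Sum>i\<le>degree D. \<Sum>j\<le>degree E. \<Sum>k\<le>j.
      monom (of_nat (j choose k) * (pderiv ^^ (j - k)) (coeff D i) * coeff E j) (i + k))"

lemma dop_act_bound:
  assumes "degree D \<le> m"
  shows "p \<bullet>\<^sub>d D = (\<Sum>j\<le>m. (pderiv ^^ j) p * coeff D j)"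
  unfolding dop_act_def using assms
  by (intro sum.mono_neutral_left) (auto simp: coeff_eq_0)

lemma dop_act_add: "p \<bullet>\<^sub>d (D + E) = p \<bullet>\<^sub>d D + p \<bullet>\<^sub>d E"
proof -
  define m where "m = max (degree D) (degree E)"
  have "degree (D + E) \<le> m" "degree D \<le> m" "degree E \<le> m"
    by (auto simp: m_def degree_add_le_max)
  then show ?thesis
    by (simp add: dop_act_bound algebra_simps sum.distrib)
qed

lemma dop_act_zero [simp]: "p \<bullet>\<^sub>d 0 = 0"
  by (simp add: dop_act_def)

lemma dop_act_sum: "p \<bullet>\<^sub>d (\<Sum>i\<in>A. F i) = (\<Sum>i\<in>A. p \<bullet>\<^sub>d F i)"
  by (induction A rule: infinite_finite_induct) (auto simp: dop_act_add)

lemma dop_act_monom: "p \<bullet>\<^sub>d monom f i = (pderiv ^^ i) p * f"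
proof -
  have "p \<bullet>\<^sub>d monom f i = (\<Sum>j\<le>i. (pderiv ^^ j) p * coeff (monom f i) j)"
    by (rule dop_act_bound) (rule degree_monom_le)
  also have "\<dots> = (\<Sum>j\<le>i. if j = i then (pderiv ^^ j) p * f else 0)"
    by (intro sum.cong) auto
  finally show ?thesis by simp
qed

lemma higher_pderiv_mult:
  fixes p q :: "complex poly"
  shows "(pderiv ^^ n) (p * q) =
    (\<Sum>k\<le>n. of_nat (n choose k) * ((pderiv ^^ k) p * (pderiv ^^ (n - k)) q))"
proof (induction n)
  case (Suc n)
  let ?t = "\<lambda>a b. (pderiv ^^ a) p * (pderiv ^^ b) q"
  have 1: "pderiv (of_nat c * ?t a b) = of_nat c * ?t (Suc a) b + of_nat c * ?t a (Suc b)"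
    for a b c
    by (simp add: pderiv_mult algebra_simps)
  have "(pderiv ^^ Suc n) (p * q) = (\<Sum>k\<le>n. pderiv (of_nat (n choose k) * ?t k (n - k)))"
    using higher_pderiv_sum[of 1] by (simp add: Suc.IH)
  also have "\<dots> = (\<Sum>k\<le>n. of_nat (n choose k) * ?t (Suc k) (n - k))
      + (\<Sum>k\<le>n. of_nat (n choose k) * ?t k (Suc (n - k)))"
    by (simp only: 1 sum.distrib)
  also have "(\<Sum>k\<le>n. of_nat (n choose k) * ?t k (Suc (n - k)))
      = (\<Sum>k\<le>Suc n. of_nat (n choose k) * ?t k (Suc n - k))"
    by (simp add: Suc_diff_le)
  also have "\<dots> = ?t 0 (Suc n) + (\<Sum>k\<le>n. of_nat (n choose Suc k) * ?t (Suc k) (n - k))"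
    by (subst sum.atMost_Suc_shift) simp
  also have "(\<Sum>k\<le>n. of_nat (n choose k) * ?t (Suc k) (n - k)) + \<dots>
      = ?t 0 (Suc n) + (\<Sum>k\<le>n. of_nat (Suc n choose Suc k) * ?t (Suc k) (Suc n - Suc k))"
    by (simp add: sum.distrib distrib_right del: funpow.simps)
  also have "\<dots> = (\<Sum>k\<le>Suc n. of_nat (Suc n choose k) * ?t k (Suc n - k))"
    by (subst sum.atMost_Suc_shift) simp
  finally show ?case .
qed simp

lemma dop_act_mult: "p \<bullet>\<^sub>d (D \<odot> E) = p \<bullet>\<^sub>d D \<bullet>\<^sub>d E"
proof -
  have 1: "(pderiv ^^ j) ((pderiv ^^ i) p * f) * g =
      (\<Sum>k\<le>j. (pderiv ^^ (i + k)) p * (of_nat (j choose k) * (pderiv ^^ (j - k)) f * g))"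
    for i j f g
  proof -
    have "(pderiv ^^ k) ((pderiv ^^ i) p) = (pderiv ^^ (i + k)) p" for k
      by (simp add: funpow_add add.commute [of i])
    then show ?thesis
      by (simp only: higher_pderiv_mult sum_distrib_right) (simp add: mult_ac)
  qed
  have "p \<bullet>\<^sub>d D \<bullet>\<^sub>d E = (\<Sum>j\<le>degree E. \<Sum>i\<le>degree D. \<Sum>k\<le>j.
      (pderiv ^^ (i + k)) p * (of_nat (j choose k) * (pderiv ^^ (j - k)) (coeff D i) * coeff E j))"
    by (simp only: dop_act_def [of _ D] dop_act_def [of _ E] higher_pderiv_sum sum_distrib_right 1)
  also have "\<dots> = p \<bullet>\<^sub>d (D \<odot> E)"
    by (subst sum.swap) (simp only: dop_mult_def dop_act_sum dop_act_monom)
  finally show ?thesis ..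
qed

lemma dop_act_faithful:
  assumes "\<And>p. p \<bullet>\<^sub>d D = p \<bullet>\<^sub>d E"
  shows "D = E"
proof -
  have z: "F = 0" if F: "\<And>p. p \<bullet>\<^sub>d F = 0" for F
  proof (rule ccontr)
    assume "F \<noteq> 0"
    define n where "n = (LEAST n. coeff F n \<noteq> 0)"
    have n: "coeff F n \<noteq> 0"
      unfolding n_def by (rule LeastI [of _ "degree F"]) (use \<open>F \<noteq> 0\<close> in simp)
    have less: "coeff F i = 0" if "i < n" for i
      using not_less_Least that unfolding n_def by blast
    define q :: "complex poly" where "q = monom 1 n"
    have greater: "(pderiv ^^ i) q = 0" if "i > n" for i
      using that by (intro poly_eqI) (auto simp: q_def coeff_higher_pderiv)
    have "0 = (\<Sum>i\<le>degree F. (pderiv ^^ i) q * coeff F i)"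
      using F [of q] by (simp add: dop_act_def)
    also have "\<dots> = (\<Sum>i\<le>degree F. if i = n then (pderiv ^^ n) q * coeff F n else 0)"
      by (intro sum.cong refl) (metis less greater linorder_neqE_nat mult_zero_left mult_zero_right)
    also have "\<dots> = (pderiv ^^ n) q * coeff F n"
      using n by (simp add: le_degree)
    finally have "(pderiv ^^ n) q = 0" using n by simp
    then have "coeff ((pderiv ^^ n) q) 0 = 0" by simp
    then show False by (simp add: q_def coeff_higher_pderiv pochhammer_fact [symmetric])
  qed
  have "p \<bullet>\<^sub>d (D - E) = 0" for p
    using dop_act_add [of p "D - E" E] assms by simp
  from z [OF this] show ?thesis by simp
qed

text \<open>
  The convention is that the zero polynomial has degree \<open>-\<infinity>\<close>, so a degree-preserving operator
  kills no nonzero constant; since \<open>degree 0 = 0\<close> in the library this is stated separately.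
\<close>

definition degree_preserving :: "diff_op \<Rightarrow> bool" where
  "degree_preserving V \<longleftrightarrow> (\<forall>p. p \<noteq> 0 \<longrightarrow> p \<bullet>\<^sub>d V \<noteq> 0 \<and> degree (p \<bullet>\<^sub>d V) = degree p)"

section \<open>Scalar weights and their monic orthogonal polynomials\<close>

text \<open>
  \<open>I\<close> is the (possibly unbounded) interval \<open>(x\<^sub>0, x\<^sub>1)\<close>, taken open so that smoothness is the
  existence of all iterated derivatives at its points.
\<close>

definition scalar_weight :: "real set \<Rightarrow> (real \<Rightarrow> real) \<Rightarrow> bool" where
  "scalar_weight I w \<longleftrightarrow>
     open I \<and> is_interval I \<and> I \<noteq> {} \<and>
     (AE x in lborel. x \<in> I \<longrightarrow> 0 < w x) \<and>
     (\<forall>n. \<forall>x\<in>I. (deriv ^^ n) w differentiable at x) \<and>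
     (\<forall>n. set_integrable lborel I (\<lambda>x. x ^ n * w x))"

definition weight_inner ::
    "real set \<Rightarrow> (real \<Rightarrow> real) \<Rightarrow> complex poly \<Rightarrow> complex poly \<Rightarrow> complex" where
  "weight_inner I w p q =
     (LINT x:I|lborel. poly p (of_real x) * cnj (poly q (of_real x)) * of_real (w x))"

definition is_monic_ortho :: "real set \<Rightarrow> (real \<Rightarrow> real) \<Rightarrow> (nat \<Rightarrow> complex poly) \<Rightarrow> bool" where
  "is_monic_ortho I w P \<longleftrightarrow>
     (\<forall>n. degree (P n) = n \<and> lead_coeff (P n) = 1) \<and>
     (\<forall>m n. m \<noteq> n \<longrightarrow> weight_inner I w (P m) (P n) = 0)"

definition monic_ortho :: "real set \<Rightarrow> (real \<Rightarrow> real) \<Rightarrow> nat \<Rightarrow> complex poly" where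
  "monic_ortho I w = (THE P. is_monic_ortho I w P)"

section \<open>The algebra of a weight and Darboux transformations\<close>

definition weight_algebra :: "real set \<Rightarrow> (real \<Rightarrow> real) \<Rightarrow> diff_op set" where
  "weight_algebra I w =
     {D. \<forall>n. \<exists>\<Lambda>. monic_ortho I w n \<bullet>\<^sub>d D = smult \<Lambda> (monic_ortho I w n)}"

text \<open>\<open>darboux_transformation I w w'\<close>: the weight \<open>w'\<close> is a Darboux transformation of \<open>w\<close>.\<close>

definition darboux_transformation ::
    "real set \<Rightarrow> (real \<Rightarrow> real) \<Rightarrow> (real \<Rightarrow> real) \<Rightarrow> bool" where
  "darboux_transformation I w w' \<longleftrightarrow>
     scalar_weight I w \<and> scalar_weight I w' \<and>
     (\<exists>D\<in>weight_algebra I w. \<exists>V N.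
        D = V \<odot> N \<and> degree_preserving V \<and> degree_preserving N \<and>
        (\<forall>n. \<exists>A. monic_ortho I w n \<bullet>\<^sub>d V = smult A (monic_ortho I w' n)))"

definition laguerre_weight :: "real \<Rightarrow> real \<Rightarrow> real" where
  "laguerre_weight \<alpha> x = exp (- x) * x powr \<alpha>"

end

theory Submission
  imports Defs
begin

text \<open>
  Write \<open>L a n\<close> for the monic Laguerre polynomial of degree \<open>n\<close> with parameter \<open>a > -1\<close>.

  If \<open>\<alpha> - \<beta>\<close> is an integer, the intertwining operators come from a ladder. The operators
  \<open>R = 1 - \<partial>\<close> and \<open>S = \<partial> x + (a + 1)\<close> are adjoint to each other, \<open>\<langle>p \<cdot> R, q\<rangle>\<close> for the parameter
  \<open>a + 1\<close> being \<open>\<langle>p, q \<cdot> S\<rangle>\<close> for the parameter \<open>a\<close> (\<open>raise_lower_adjoint\<close>). This is integration by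
  parts for the measure \<open>exp(-x) x^(a+1) dx\<close>, or equivalently the recurrence \<open>\<Gamma>(z+1) = z \<Gamma>(z)\<close> of
  its moments. Both operators preserve degrees, and an operator whose adjoint preserves degrees maps
  a polynomial orthogonal to all polynomials of lower degree to another such polynomial. Hence
  \<open>L a n \<cdot> R = L (a+1) n\<close> and \<open>L (a+1) n \<cdot> S = (n+a+1) L a n\<close>, where the factor is read off the
  leading coefficients. Composing \<open>\<bar>\<alpha> - \<beta>\<bar>\<close> of these steps in each of the two directions gives
  two operators \<open>V\<close> and \<open>N\<close>, and \<open>V \<odot> N\<close> is in the algebra of the weight because it multiplies each orthogonal
  polynomial by a scalar.

  Conversely, let \<open>V\<close> preserve degrees and satisfy \<open>L \<beta> n \<cdot> V = A n \<sqdot> L \<alpha> n\<close> for all \<open>n\<close>. Comparing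
  leading coefficients shows that \<open>A n\<close> is a polynomial in \<open>n\<close> (\<open>coeff_degree_act\<close>); its values at
  natural numbers are nonzero because \<open>V\<close> kills no nonzero polynomial. The recurrence for consecutive
  coefficients that comes from
  \<open>L a n \<cdot> R S = (n+a+1) L a n\<close> shows that the \<open>j\<close>-th derivative of \<open>L \<beta> n\<close> at 0 is a polynomial in
  \<open>n\<close> times \<open>L \<beta> n (0)\<close>, so \<open>(L \<beta> n \<cdot> V)(0) = Q(n) \<sqdot> L \<beta> n (0)\<close> for a polynomial \<open>Q\<close>
  (\<open>coeff_0_laguerre_act\<close>). Since \<open>L a n (0) = (-1)^n (a+1)(a+2)\<dots>(a+n)\<close>, comparing values at 0 gives
  \[ \frac{\Gamma(n+\alpha+1)}{\Gamma(n+\beta+1)} = \mathrm{const} \cdot \frac{Q(n)}{A(n)} . \]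
  The left side grows like \<open>n\<close> to the power \<open>\<alpha> - \<beta>\<close> and the right side like an integer power of \<open>n\<close>, so
  \<open>\<alpha> - \<beta>\<close> is an integer (\<open>pochhammer_ratio_rational_imp_int\<close>).
\<close>

section \<open>The integral and the inner product of a weight\<close>

text \<open>
  The inner product of \<open>p\<close> and \<open>q\<close> depends only on the product of \<open>p\<close> with the conjugate of \<open>q\<close>. So
  adjointness of two operators is an identity for this linear functional, and it can be checked on
  moments.
\<close>

definition weight_integral :: "real set \<Rightarrow> (real \<Rightarrow> real) \<Rightarrow> complex poly \<Rightarrow> complex" where
  "weight_integral I w p = (LINT x:I|lborel. poly p (of_real x) * of_real (w x))"

lemma set_integrable_poly_weight:
  fixes p :: "complex poly"
  assumes "scalar_weight I w"
  shows "set_integrable lborel I (\<lambda>x. poly p (of_real x) * of_real (w x))"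
proof -
  have m: "set_integrable lborel I (\<lambda>x. complex_of_real (x ^ i * w x))" for i
  proof -
    have "integrable lborel (\<lambda>x. complex_of_real (indicator I x *\<^sub>R (x ^ i * w x)))"
      using assms unfolding scalar_weight_def set_integrable_def by (intro integrable_of_real) blast
    then show ?thesis
      unfolding set_integrable_def by (simp add: scaleR_conv_of_real)
  qed
  have "set_integrable lborel I (\<lambda>x. coeff p i * complex_of_real (x ^ i * w x))" for i
    using m by (rule set_integrable_mult_right)
  then have "integrable lborel (\<lambda>x. \<Sum>i\<le>degree p. indicator I x *\<^sub>R (coeff p i * complex_of_real (x ^ i * w x)))"
    unfolding set_integrable_def by (intro Bochner_Integration.integrable_sum)
  moreover have "(\<Sum>i\<le>degree p. indicator I x *\<^sub>R (coeff p i * complex_of_real (x ^ i * w x)))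
      = indicator I x *\<^sub>R (poly p (of_real x) * of_real (w x))" for x
    by (cases "x \<in> I") (simp_all add: poly_altdef sum_distrib_left mult_ac)
  ultimately show ?thesis
    unfolding set_integrable_def by simp
qed

lemma weight_integral_zero [simp]: "weight_integral I w 0 = 0"
  by (simp add: weight_integral_def)

lemma weight_integral_add:
  assumes "scalar_weight I w"
  shows "weight_integral I w (p + q) = weight_integral I w p + weight_integral I w q"
  unfolding weight_integral_def
  using set_integral_add(2)[OF set_integrable_poly_weight[OF assms] set_integrable_poly_weight[OF assms]]
  by (simp add: distrib_right)

lemma weight_integral_smult: "weight_integral I w (smult c p) = c * weight_integral I w p"
  unfolding weight_integral_def by (simp add: mult.assoc)

lemma weight_integral_diff:
  assumes "scalar_weight I w"
  shows "weight_integral I w (p - q) = weight_integral I w p - weight_integral I w q"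
  using weight_integral_add[OF assms, of p "smult (-1) q"]
  by (simp only: weight_integral_smult) simp

lemma weight_inner_eq_integral:
  "weight_inner I w p q = weight_integral I w (p * map_poly cnj q)"
  unfolding weight_inner_def weight_integral_def by simp

lemma map_poly_cnj_add [simp]: "map_poly cnj (p + q) = map_poly cnj p + map_poly cnj q"
  by (intro poly_eqI) (simp add: coeff_map_poly)

lemma map_poly_cnj_smult [simp]: "map_poly cnj (smult c p) = smult (cnj c) (map_poly cnj p)"
  by (intro poly_eqI) (simp add: coeff_map_poly)

lemma weight_inner_add_left:
  assumes "scalar_weight I w"
  shows "weight_inner I w (p + q) r = weight_inner I w p r + weight_inner I w q r"
  by (simp add: weight_inner_eq_integral distrib_right weight_integral_add[OF assms])

lemma weight_inner_add_right:
  assumes "scalar_weight I w"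
  shows "weight_inner I w r (p + q) = weight_inner I w r p + weight_inner I w r q"
  by (simp add: weight_inner_eq_integral distrib_left weight_integral_add[OF assms])

lemma weight_inner_smult_left: "weight_inner I w (smult c p) q = c * weight_inner I w p q"
  by (simp add: weight_inner_eq_integral weight_integral_smult)

lemma weight_inner_smult_right: "weight_inner I w p (smult c q) = cnj c * weight_inner I w p q"
  by (simp add: weight_inner_eq_integral weight_integral_smult)

lemma weight_inner_zero_right [simp]: "weight_inner I w p 0 = 0"
  by (simp add: weight_inner_def)

lemma weight_inner_zero_left [simp]: "weight_inner I w 0 p = 0"
  by (simp add: weight_inner_def)

lemma weight_inner_cnj: "cnj (weight_inner I w p q) = weight_inner I w q p"
  unfolding weight_inner_def set_lebesgue_integral_def
  by (subst Bochner_Integration.integral_cnj [symmetric])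
     (intro Bochner_Integration.integral_cong, auto simp: mult_ac indicator_def)

lemma weight_inner_sum_left:
  assumes "scalar_weight I w"
  shows "weight_inner I w (\<Sum>i\<in>A. f i) q = (\<Sum>i\<in>A. weight_inner I w (f i) q)"
  by (induction A rule: infinite_finite_induct) (auto simp: weight_inner_add_left[OF assms])

lemma weight_inner_diff_left:
  assumes "scalar_weight I w"
  shows "weight_inner I w (p - q) r = weight_inner I w p r - weight_inner I w q r"
  using weight_inner_add_left[OF assms, of p "smult (-1) q" r]
  by (simp only: weight_inner_smult_left) simp

text \<open>
  If \<open>\<bar>p\<bar>\<^sup>2 w\<close> integrates to 0, it vanishes almost everywhere, and as \<open>w\<close> is positive almost everywhere,
  almost all points of \<open>I\<close> are zeros of \<open>p\<close>. A nonzero polynomial has finitely many zeros, while a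
  nonempty open set is not negligible.
\<close>

lemma weight_inner_definite:
  assumes w: "scalar_weight I w" and "weight_inner I w p p = 0"
  shows "p = 0"
proof (rule ccontr)
  assume "p \<noteq> 0"
  let ?f = "\<lambda>x. indicator I x * ((cmod (poly p (of_real x)))\<^sup>2 * w x)"
  have I: "open I" "I \<noteq> {}" and pos: "AE x in lborel. x \<in> I \<longrightarrow> 0 < w x"
    using w by (auto simp: scalar_weight_def)
  have eq: "indicat_real I x *\<^sub>R (poly (p * map_poly cnj p) (of_real x) * of_real (w x)) = complex_of_real (?f x)" for x
    by (simp add: complex_norm_square [symmetric] scaleR_conv_of_real del: of_real_power)
  have int: "integrable lborel (\<lambda>x. complex_of_real (?f x))"
    using set_integrable_poly_weight[OF w, of "p * map_poly cnj p"]
    unfolding set_integrable_def eq .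
  have int': "integrable lborel ?f"
    using int by (simp only: complex_of_real_integrable_eq)
  have "complex_of_real (integral\<^sup>L lborel ?f) = 0"
    using assms(2)
    unfolding weight_inner_eq_integral weight_integral_def set_lebesgue_integral_def eq
    by (simp only: integral_complex_of_real)
  then have "integral\<^sup>L lborel ?f = 0" by simp
  moreover have "AE x in lborel. 0 \<le> ?f x"
    using pos by eventually_elim (auto simp: indicator_def)
  ultimately have "AE x in lborel. ?f x = 0"
    using integral_nonneg_eq_0_iff_AE[OF int'] by blast
  with pos have "AE x in lborel. x \<notin> I - {x. poly p (of_real x) = 0}"
    by eventually_elim (auto simp: indicator_def)
  moreover have fin: "finite {x::real. poly p (of_real x) = 0}"
    using poly_roots_finite[OF \<open>p \<noteq> 0\<close>] finite_vimageI[of "{z. poly p z = 0}" complex_of_real]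
    by (simp add: vimage_def inj_on_def)
  moreover have "AE x in lborel. x \<notin> {x::real. poly p (of_real x) = 0}"
    using fin by (intro AE_not_in finite_imp_null_set_lborel)
  ultimately have "AE x in lborel. x \<notin> I"
    by (auto elim: eventually_elim2)
  then have "I \<in> null_sets lborel"
    using I by (subst AE_iff_null_sets) auto
  then have "negligible I"
    by (simp add: negligible_iff_null_sets null_sets_completionI)
  then show False using open_not_negligible[OF I] by simp
qed

section \<open>Existence and uniqueness of monic orthogonal polynomials\<close>

text \<open>
  Monic polynomials of the degrees \<open>0, \<dots>, n - 1\<close> span all polynomials of degree below \<open>n\<close>: subtract the
  multiple of \<open>P (degree q)\<close> with the leading coefficient of \<open>q\<close> and induct.
\<close>

lemma weight_inner_lower_degree:
  assumes w: "scalar_weight I w"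
    and P: "\<And>k. k < n \<Longrightarrow> degree (P k) = k \<and> lead_coeff (P k) = 1 \<and> weight_inner I w p (P k) = 0"
    and "degree q < n"
  shows "weight_inner I w p q = 0"
  using \<open>degree q < n\<close>
proof (induction "degree q" arbitrary: q rule: less_induct)
  case less
  define d c r where "d = degree q" and "c = lead_coeff q" and "r = q - smult c (P d)"
  have "d < n" using less.prems by (simp add: d_def)
  note Pd = P[OF this]
  have split: "q = smult c (P d) + r" by (simp add: r_def)
  have *: "weight_inner I w p r = 0"
  proof (cases "d = 0")
    case True
    then obtain a b where "q = [:a:]" "P d = [:b:]"
      using Pd by (metis d_def degree_eq_zeroE)
    then have "r = 0" using Pd by (auto simp: r_def c_def)
    then show ?thesis by simp
  next
    case False
    have "degree r \<le> d"
      unfolding r_def using Pd by (intro degree_diff_le) (auto simp: d_def)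
    moreover have "coeff r d = 0"
    proof -
      have "coeff (P d) d = 1" using Pd by metis
      then show ?thesis by (simp add: r_def c_def d_def)
    qed
    ultimately have "degree r < d"
      using False by (metis le_less leading_coeff_0_iff degree_0 gr0I)
    then show ?thesis using less \<open>d < n\<close> by (auto simp: d_def)
  qed
  show ?case
    by (subst split) (simp add: weight_inner_add_right[OF w] weight_inner_smult_right Pd *)
qed

text \<open>
  Orthogonality to all lower degrees pins down each member of the orthogonal family without reference
  to the other members. This is the form in which adjointness transports it from one weight to another.
\<close>

definition ortho_below :: "real set \<Rightarrow> (real \<Rightarrow> real) \<Rightarrow> nat \<Rightarrow> complex poly \<Rightarrow> bool" where
  "ortho_below I w n p \<longleftrightarrow>
     degree p = n \<and> lead_coeff p = 1 \<and> (\<forall>q. degree q < n \<longrightarrow> weight_inner I w p q = 0)"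

text \<open>
  The difference of two candidates has lower degree, so it is orthogonal to both of them and hence to
  itself.
\<close>

lemma ortho_below_unique:
  assumes w: "scalar_weight I w" and p: "ortho_below I w n p" and q: "ortho_below I w n q"
  shows "p = q"
proof (cases "n = 0")
  case True
  with p q show ?thesis unfolding ortho_below_def by (metis degree_eq_zeroE lead_coeff_pCons(2))
next
  case False
  have "degree (p - q) \<le> n"
    using p q by (intro degree_diff_le) (auto simp: ortho_below_def)
  moreover have "coeff (p - q) n = 0"
    using p q by (auto simp: ortho_below_def)
  ultimately have "degree (p - q) < n"
    using False by (metis le_less leading_coeff_0_iff degree_0 gr0I)
  then have "weight_inner I w (p - q) (p - q) = 0"
    using p q by (simp add: ortho_below_def weight_inner_diff_left[OF w])
  then show ?thesis using weight_inner_definite[OF w] by fastforce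
qed

text \<open>
  Gram--Schmidt orthogonalisation of the monomials.
\<close>

lemma ortho_below_exists:
  assumes w: "scalar_weight I w"
  shows "\<exists>p. ortho_below I w n p"
proof (induction n rule: less_induct)
  case (less n)
  then obtain P where P: "\<And>k. k < n \<Longrightarrow> ortho_below I w k (P k)" by metis
  have orth: "weight_inner I w (P j) (P k) = 0" if "j < n" "k < n" "j \<noteq> k" for j k
  proof (cases "k < j")
    case True
    then show ?thesis using P that by (auto simp: ortho_below_def)
  next
    case False
    then have "weight_inner I w (P k) (P j) = 0" using P that by (auto simp: ortho_below_def)
    then show ?thesis by (metis weight_inner_cnj complex_cnj_zero)
  qed
  have nz: "weight_inner I w (P k) (P k) \<noteq> 0" if "k < n" for k
    using weight_inner_definite[OF w] P[OF that] by (force simp: ortho_below_def)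
  define c where "c k = weight_inner I w (monom 1 n) (P k) / weight_inner I w (P k) (P k)" for k
  define s where "s = (\<Sum>k<n. smult (c k) (P k))"
  have s0: "coeff s m = 0" if "m \<ge> n" for m
    unfolding s_def coeff_sum
    using that P by (intro sum.neutral) (auto simp: ortho_below_def coeff_eq_0)
  define p where "p = monom 1 n - s"
  have cn: "coeff p n = 1" using s0 by (simp add: p_def)
  have "degree p \<le> n" using s0 by (intro degree_le) (auto simp: p_def)
  then have deg: "degree p = n" using cn le_degree[of p n] by simp
  have "weight_inner I w p (P k) = 0" if "k < n" for k
  proof -
    have "weight_inner I w s (P k) = (\<Sum>j<n. if j = k then c k * weight_inner I w (P k) (P k) else 0)"
      unfolding s_def weight_inner_sum_left[OF w] weight_inner_smult_left
      using orth that by (intro sum.cong) auto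
    also have "\<dots> = weight_inner I w (monom 1 n) (P k)"
      using that nz by (simp add: c_def)
    finally show ?thesis by (simp add: p_def weight_inner_diff_left[OF w])
  qed
  then have "weight_inner I w p q = 0" if "degree q < n" for q
    using weight_inner_lower_degree[OF w, of n P p q] P that unfolding ortho_below_def by blast
  then show ?case using deg cn by (auto simp: ortho_below_def)
qed

lemma is_monic_ortho_iff:
  assumes w: "scalar_weight I w"
  shows "is_monic_ortho I w P \<longleftrightarrow> (\<forall>n. ortho_below I w n (P n))"
proof
  assume P: "is_monic_ortho I w P"
  show "\<forall>n. ortho_below I w n (P n)"
  proof
    fix n
    have "weight_inner I w (P n) q = 0" if "degree q < n" for q
      using weight_inner_lower_degree[OF w _ that, of P "P n"] P unfolding is_monic_ortho_def
      by (metis less_irrefl)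
    then show "ortho_below I w n (P n)"
      using P unfolding is_monic_ortho_def ortho_below_def by blast
  qed
next
  assume P: "\<forall>n. ortho_below I w n (P n)"
  have *: "weight_inner I w (P m) (P n) = 0" if "n < m" for m n
    using P that by (auto simp: ortho_below_def)
  then have "weight_inner I w (P n) (P m) = 0" if "n < m" for m n
    using that by (metis weight_inner_cnj complex_cnj_zero)
  with * show "is_monic_ortho I w P"
    using P unfolding is_monic_ortho_def ortho_below_def by (metis linorder_neqE_nat)
qed

text \<open>
  Existence and uniqueness resolve the definite description in \<open>monic_ortho\<close>; from here on a monic
  polynomial is identified by testing it against lower degrees.
\<close>

lemma monic_ortho_eq_iff:
  assumes w: "scalar_weight I w"
  shows "monic_ortho I w n = p \<longleftrightarrow> ortho_below I w n p"
proof -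
  have "\<exists>!P. is_monic_ortho I w P"
    unfolding is_monic_ortho_iff[OF w] using ortho_below_exists[OF w] ortho_below_unique[OF w]
    by (auto intro!: ex_ex1I ext dest: choice) metis
  then have "is_monic_ortho I w (monic_ortho I w)"
    unfolding monic_ortho_def by (rule theI')
  then have "ortho_below I w n (monic_ortho I w n)"
    unfolding is_monic_ortho_iff[OF w] by blast
  then show ?thesis using ortho_below_unique[OF w] by blast
qed

section \<open>Moments of the Laguerre weight\<close>

text \<open>
  Each differentiation lowers the exponent of \<open>x\<close> by one and keeps the rest of the product polynomial;
  this closed form makes smoothness on the half-line a matter of differentiating explicit functions.
\<close>

lemma laguerre_higher_deriv:
  "\<exists>r :: real poly. \<forall>x>0. (deriv ^^ n) (laguerre_weight a) x
     = exp (- x) * x powr (a - real n) * poly r x"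
proof (induction n)
  case 0
  show ?case by (rule exI [of _ 1]) (simp add: laguerre_weight_def)
next
  case (Suc n)
  then obtain r :: "real poly" where r: "\<And>x. x > 0 \<Longrightarrow> (deriv ^^ n) (laguerre_weight a) x
     = exp (- x) * x powr (a - real n) * poly r x" by blast
  define s where "s = smult (a - real n) r + [:0, 1:] * pderiv r - [:0, 1:] * r"
  have "(deriv ^^ Suc n) (laguerre_weight a) x = exp (- x) * x powr (a - real (Suc n)) * poly s x"
    if x: "x > 0" for x
  proof -
    have pw: "x powr (a - real n) = x * x powr (a - real (Suc n))"
      using x powr_mult_base[of x "a - real (Suc n)"] by simp
    have "((\<lambda>x. exp (- x) * x powr (a - real n) * poly r x) has_field_derivative
        (- exp (- x) * x powr (a - real n) + exp (- x) * ((a - real n) * x powr (a - real (Suc n)))) * poly r x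
         + exp (- x) * x powr (a - real n) * poly (pderiv r) x) (at x)"
      using x by (auto intro!: derivative_eq_intros poly_DERIV simp: algebra_simps)
    then have "((deriv ^^ n) (laguerre_weight a) has_field_derivative
        (- exp (- x) * x powr (a - real n) + exp (- x) * ((a - real n) * x powr (a - real (Suc n)))) * poly r x
         + exp (- x) * x powr (a - real n) * poly (pderiv r) x) (at x)"
      by (rule has_field_derivative_transform_within_open[where S = "{0<..}"]) (use x r in auto)
    then have "(deriv ^^ Suc n) (laguerre_weight a) x =
        (- exp (- x) * x powr (a - real n) + exp (- x) * ((a - real n) * x powr (a - real (Suc n)))) * poly r x
         + exp (- x) * x powr (a - real n) * poly (pderiv r) x"
      by (simp add: DERIV_imp_deriv)
    then show ?thesis
      unfolding pw by (simp add: s_def algebra_simps)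
  qed
  then show ?case by blast
qed

lemma laguerre_smooth:
  assumes "x > 0"
  shows "(deriv ^^ n) (laguerre_weight a) differentiable at x"
proof -
  obtain r :: "real poly" where r: "\<And>x. x > 0 \<Longrightarrow> (deriv ^^ n) (laguerre_weight a) x
     = exp (- x) * x powr (a - real n) * poly r x" using laguerre_higher_deriv[of n a] by blast
  have "\<exists>D. ((\<lambda>x. exp (- x) * x powr (a - real n) * poly r x) has_field_derivative D) (at x)"
    using assms by (intro exI) (auto intro!: derivative_eq_intros poly_DERIV)
  then obtain D where
    "((\<lambda>x. exp (- x) * x powr (a - real n) * poly r x) has_field_derivative D) (at x)" by blast
  then have "((deriv ^^ n) (laguerre_weight a) has_field_derivative D) (at x)"
    by (rule has_field_derivative_transform_within_open[where S = "{0<..}"]) (use assms r in auto)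
  then show ?thesis
    by (metis real_differentiable_def)
qed

lemma laguerre_moment:
  assumes "a > -1"
  shows "set_integrable lborel {0<..} (\<lambda>x. x ^ n * laguerre_weight a x)" (is ?A)
    and "(LINT x:{0<..}|lborel. x ^ n * laguerre_weight a x) = Gamma (a + real n + 1)" (is ?B)
proof -
  let ?f = "\<lambda>x. x ^ n * laguerre_weight a x"
  let ?z = "a + real n + 1"
  have z: "?z > 0" using assms by simp
  have eq: "x powr (?z - 1) / exp x = ?f x" if "x > 0" for x
    using that by (simp add: laguerre_weight_def powr_add powr_realpow exp_minus divide_inverse mult_ac)
  have "((\<lambda>x. x powr (?z - 1) / exp x) has_integral Gamma ?z) {0<..}"
    using Gamma_integral_real[OF z]
    by (rule has_integral_spike_set_eq[THEN iffD1, rotated 2])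
       (auto intro: negligible_subset[of "{0}"])
  then have int: "(?f has_integral Gamma ?z) {0<..}"
    by (rule has_integral_eq[rotated]) (rule eq, simp)
  then have "?f absolutely_integrable_on {0<..}"
    by (subst absolutely_integrable_on_iff_nonneg)
       (auto simp: laguerre_weight_def has_integral_integrable)
  moreover have "set_borel_measurable lborel {0<..} ?f"
    unfolding set_borel_measurable_def laguerre_weight_def by measurable
  ultimately show A: ?A
    unfolding set_integrable_def set_borel_measurable_def
    by (simp only: integrable_completion)
  show ?B
    using set_borel_integral_eq_integral(2)[OF A] int by (simp add: integral_unique)
qed

lemma scalar_weight_laguerre:
  assumes "a > -1"
  shows "scalar_weight {0<..} (laguerre_weight a)"
  unfolding scalar_weight_def
  using laguerre_smooth laguerre_moment(1)[OF assms]
  by (auto simp: is_interval_def laguerre_weight_def intro: exI[of _ 1])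

abbreviation laguerre_integral :: "real \<Rightarrow> complex poly \<Rightarrow> complex" where
  "laguerre_integral a \<equiv> weight_integral {0<..} (laguerre_weight a)"

lemma laguerre_integral_monom:
  assumes "a > -1"
  shows "laguerre_integral a (monom 1 n) = of_real (Gamma (a + real n + 1))"
proof -
  have "laguerre_integral a (monom 1 n)
      = (LINT x:{0<..}|lborel. complex_of_real (x ^ n * laguerre_weight a x))"
    by (simp add: weight_integral_def poly_monom)
  also have "\<dots> = of_real (LINT x:{0<..}|lborel. x ^ n * laguerre_weight a x)"
    by (rule set_integral_complex_of_real)
  finally show ?thesis by (simp add: laguerre_moment(2)[OF assms])
qed

lemma laguerre_integral_shift:
  "laguerre_integral (a + 1) p = laguerre_integral a ([:0, 1:] * p)"
  unfolding weight_integral_def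
  by (intro set_lebesgue_integral_cong)
     (auto simp: laguerre_weight_def powr_add mult_ac)

text \<open>
  For a polynomial \<open>p\<close> the integrand is the derivative of \<open>x^(a+1) exp(-x) p\<close>, which vanishes at both
  ends of the half-line. On monomials this is the functional equation of the Gamma function, and
  linearity gives the rest.
\<close>

lemma laguerre_integral_by_parts:
  assumes a: "a > -1"
  shows "laguerre_integral a (smult (of_real (a + 1)) p + [:0, 1:] * pderiv p - [:0, 1:] * p) = 0"
proof -
  note w = scalar_weight_laguerre[OF a]
  \<comment> \<open>It suffices to treat monomials, since \<open>T\<close> is linear.\<close>
  define T :: "complex poly \<Rightarrow> complex poly"
    where "T p = smult (of_real (a + 1)) p + [:0, 1:] * pderiv p - [:0, 1:] * p" for p
  have T_add: "T (p + q) = T p + T q" for p q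
    by (simp add: T_def smult_add_right pderiv_add algebra_simps)
  have T_smult: "T (smult c p) = smult c (T p)" for p c
    by (simp add: T_def pderiv_smult smult_add_right smult_diff_right mult.commute)
  have T_0: "T 0 = 0" by (simp add: T_def)
  have mon: "laguerre_integral a (T (monom 1 n)) = 0" for n
  proof -
    have "T (monom 1 n) = smult (of_real (a + real n + 1)) (monom 1 n) - monom 1 (Suc n)"
      by (intro poly_eqI)
         (auto simp: T_def coeff_pCons coeff_pderiv algebra_simps split: nat.splits)
    moreover have "Gamma (a + real (Suc n) + 1) = (a + real n + 1) * Gamma (a + real n + 1)"
      using Gamma_plus1[of "a + real n + 1"] a nonpos_Ints_nonpos[of "a + real n + 1"]
      by (auto simp: algebra_simps)
    ultimately show ?thesis
      by (simp add: weight_integral_diff[OF w] weight_integral_smult laguerre_integral_monom[OF a])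
  qed
  have "laguerre_integral a (T (\<Sum>i\<in>A. smult (c i) (monom 1 i))) = 0" for A :: "nat set" and c
    by (induction A rule: infinite_finite_induct)
       (simp_all add: T_0 T_add T_smult weight_integral_add[OF w] weight_integral_smult mon)
  from this[of "coeff p" "{..degree p}"] show ?thesis
    by (simp add: T_def smult_monom poly_as_sum_of_monoms)
qed

section \<open>Intertwining operators\<close>

lemma dop_act_add_left: "(p + q) \<bullet>\<^sub>d D = p \<bullet>\<^sub>d D + q \<bullet>\<^sub>d D"
  by (simp add: dop_act_def higher_pderiv_add distrib_right sum.distrib)

lemma dop_act_smult_left: "smult c p \<bullet>\<^sub>d D = smult c (p \<bullet>\<^sub>d D)"
  by (simp add: dop_act_def higher_pderiv_smult sum_distrib_left[of "[:c:]", simplified])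

lemma dop_act_first_order: "p \<bullet>\<^sub>d [:f, g:] = p * f + pderiv p * g"
  by (subst dop_act_bound[of _ 1]) simp_all

lemma dop_act_one: "p \<bullet>\<^sub>d 1 = p"
  by (simp add: dop_act_def)

text \<open>
  The condition on \<open>V\<close> in a Darboux transformation. Such operators compose, so
  those for a large shift of the parameter can be built from unit shifts.
\<close>

definition intertwines :: "real set \<Rightarrow> (real \<Rightarrow> real) \<Rightarrow> (real \<Rightarrow> real) \<Rightarrow> diff_op \<Rightarrow> bool" where
  "intertwines I w w' V \<longleftrightarrow> degree_preserving V \<and>
     (\<forall>n. \<exists>A. monic_ortho I w n \<bullet>\<^sub>d V = smult A (monic_ortho I w' n))"

lemma intertwines_one: "intertwines I w w 1"
  by (auto simp: intertwines_def degree_preserving_def dop_act_one intro: exI[of _ 1])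

lemma intertwines_mult:
  assumes "intertwines I w w' V" "intertwines I w' w'' N"
  shows "intertwines I w w'' (V \<odot> N)"
  unfolding intertwines_def
proof (intro conjI allI)
  show "degree_preserving (V \<odot> N)"
    using assms by (simp add: intertwines_def degree_preserving_def dop_act_mult)
  fix n
  obtain A B where "monic_ortho I w n \<bullet>\<^sub>d V = smult A (monic_ortho I w' n)"
    "monic_ortho I w' n \<bullet>\<^sub>d N = smult B (monic_ortho I w'' n)"
    using assms unfolding intertwines_def by meson
  then show "\<exists>A. monic_ortho I w n \<bullet>\<^sub>d (V \<odot> N) = smult A (monic_ortho I w'' n)"
    by (auto simp: dop_act_mult dop_act_smult_left)
qed

text \<open>
  The product of intertwining operators in both directions intertwines \<open>w\<close> with itself, which is
  membership in the algebra of \<open>w\<close>.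
\<close>

lemma darboux_transformationI:
  assumes "scalar_weight I w" "scalar_weight I w'"
    and "intertwines I w w' V" "intertwines I w' w N"
  shows "darboux_transformation I w w'"
proof -
  have "V \<odot> N \<in> weight_algebra I w"
    using intertwines_mult[OF assms(3,4)] by (simp add: intertwines_def weight_algebra_def)
  then show ?thesis
    using assms unfolding darboux_transformation_def intertwines_def by blast
qed

section \<open>Ladder operators of the Laguerre polynomials\<close>

abbreviation laguerre_poly :: "real \<Rightarrow> nat \<Rightarrow> complex poly" where
  "laguerre_poly a \<equiv> monic_ortho {0<..} (laguerre_weight a)"

text \<open>
  \<open>raise_op\<close> is \<open>1 - \<partial>\<close> and takes the parameter \<open>a\<close> to \<open>a + 1\<close>; \<open>lower_op a\<close> is \<open>\<partial> x + (a + 1)\<close>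
  and takes \<open>a + 1\<close> back to \<open>a\<close>. On classical Laguerre polynomials these are the contiguous relations.
\<close>

definition raise_op :: diff_op where
  "raise_op = [:1, - 1:]"

definition lower_op :: "real \<Rightarrow> diff_op" where
  "lower_op a = [:[:of_real (a + 1):], [:0, 1:]:]"

lemma act_raise_op: "p \<bullet>\<^sub>d raise_op = p - pderiv p"
  by (simp add: raise_op_def dop_act_first_order)

lemma act_lower_op: "p \<bullet>\<^sub>d lower_op a = smult (of_real (a + 1)) p + [:0, 1:] * pderiv p"
  by (simp add: lower_op_def dop_act_first_order algebra_simps)

text \<open>
  As the weight for \<open>a + 1\<close> is \<open>x\<close> times the weight for \<open>a\<close>, both sides are integrals for the
  parameter \<open>a\<close>. The difference of the integrands is the derivative that
  \<open>laguerre_integral_by_parts\<close> integrates to 0, taken for the product of \<open>p\<close> with the conjugate of \<open>q\<close>.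
  Here it matters that \<open>a\<close> is real: conjugation then commutes with the action of \<open>lower_op a\<close>.
\<close>

lemma raise_lower_adjoint:
  assumes a: "a > -1"
  shows "weight_inner {0<..} (laguerre_weight (a + 1)) (p \<bullet>\<^sub>d raise_op) q
       = weight_inner {0<..} (laguerre_weight a) p (q \<bullet>\<^sub>d lower_op a)"
proof -
  note w = scalar_weight_laguerre[OF a]
  let ?q = "map_poly cnj q"
  let ?s = "p * ?q"
  have cnj_pderiv: "map_poly cnj (pderiv r) = pderiv (map_poly cnj r)" for r
    by (intro poly_eqI) (simp add: coeff_map_poly coeff_pderiv)
  have cnj_x: "map_poly cnj ([:0, 1:] * r) = [:0, 1:] * map_poly cnj r" for r
    by (intro poly_eqI) (simp add: coeff_map_poly coeff_pCons split: nat.splits)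
  have qN: "map_poly cnj (q \<bullet>\<^sub>d lower_op a) = smult (of_real (a + 1)) ?q + [:0, 1:] * pderiv ?q"
    by (simp only: act_lower_op map_poly_cnj_add map_poly_cnj_smult cnj_pderiv cnj_x
        complex_cnj_complex_of_real)
  have "p * map_poly cnj (q \<bullet>\<^sub>d lower_op a) - [:0, 1:] * ((p \<bullet>\<^sub>d raise_op) * ?q)
      = smult (of_real (a + 1)) ?s + [:0, 1:] * pderiv ?s - [:0, 1:] * ?s"
    unfolding qN act_raise_op pderiv_mult by (simp add: algebra_simps)
  then have "laguerre_integral a (p * map_poly cnj (q \<bullet>\<^sub>d lower_op a))
      - laguerre_integral a ([:0, 1:] * ((p \<bullet>\<^sub>d raise_op) * ?q)) = 0"
    using laguerre_integral_by_parts[OF a, of ?s] by (simp only: weight_integral_diff[OF w, symmetric])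
  then show ?thesis
    by (simp add: weight_inner_eq_integral laguerre_integral_shift)
qed

lemma coeff_raise_op: "coeff (p \<bullet>\<^sub>d raise_op) k = coeff p k - of_nat (Suc k) * coeff p (Suc k)"
  by (simp add: act_raise_op coeff_pderiv)

lemma coeff_lower_op: "coeff (p \<bullet>\<^sub>d lower_op a) k = of_real (a + 1 + real k) * coeff p k"
  by (cases k) (simp_all add: act_lower_op coeff_pderiv algebra_simps)

lemma lower_factor_nonzero:
  assumes "a > -1"
  shows "complex_of_real (a + 1 + real k) \<noteq> 0"
  using assms by (subst of_real_eq_0_iff) linarith

lemma degree_eqI:
  fixes p :: "'a::zero poly"
  assumes "\<And>k. k > n \<Longrightarrow> coeff p k = 0" "coeff p n \<noteq> 0"
  shows "degree p = n"
  using assms by (meson antisym degree_le le_degree)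

lemma degree_raise_op: "degree (p \<bullet>\<^sub>d raise_op) = degree p"
proof (cases "p = 0")
  case True
  then show ?thesis by (simp add: act_raise_op)
next
  case False
  then show ?thesis by (intro degree_eqI) (simp_all add: coeff_raise_op coeff_eq_0)
qed

lemma degree_lower_op:
  assumes "a > -1"
  shows "degree (p \<bullet>\<^sub>d lower_op a) = degree p"
proof (cases "p = 0")
  case True
  then show ?thesis by (simp add: act_lower_op)
next
  case False
  then show ?thesis
    using lower_factor_nonzero[OF assms]
    by (intro degree_eqI) (simp_all add: coeff_lower_op coeff_eq_0 del: of_real_add)
qed

text \<open>
  If \<open>degree q < n\<close>, then \<open>q \<cdot> lower_op a\<close> has degree below \<open>n\<close> as well and is orthogonal to
  \<open>laguerre_poly a n\<close>. By adjointness the raised polynomial is orthogonal to \<open>q\<close>.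
\<close>

lemma laguerre_raise:
  assumes a: "a > -1"
  shows "laguerre_poly a n \<bullet>\<^sub>d raise_op = laguerre_poly (a + 1) n"
proof -
  let ?p = "laguerre_poly a n"
  have "scalar_weight {0<..} (laguerre_weight (a + 1))"
    using a by (intro scalar_weight_laguerre) simp
  moreover have p: "ortho_below {0<..} (laguerre_weight a) n ?p"
    using monic_ortho_eq_iff[OF scalar_weight_laguerre[OF a]] by blast
  then have "ortho_below {0<..} (laguerre_weight (a + 1)) n (?p \<bullet>\<^sub>d raise_op)"
    by (auto simp: ortho_below_def degree_raise_op coeff_raise_op coeff_eq_0
        raise_lower_adjoint[OF a] degree_lower_op[OF a])
  ultimately show ?thesis by (metis monic_ortho_eq_iff)
qed

text \<open>
  The same argument with the two operators exchanged. The image is not monic: \<open>lower_op a\<close> multiplies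
  the coefficient of \<open>x^n\<close> by \<open>a + 1 + n\<close>, which is nonzero because \<open>a > -1\<close>.
\<close>

lemma laguerre_lower:
  assumes a: "a > -1"
  shows "laguerre_poly (a + 1) n \<bullet>\<^sub>d lower_op a = smult (of_real (a + 1 + real n)) (laguerre_poly a n)"
proof -
  let ?p = "laguerre_poly (a + 1) n" and ?c = "complex_of_real (a + 1 + real n)"
  have w: "scalar_weight {0<..} (laguerre_weight (a + 1))"
    using a by (intro scalar_weight_laguerre) simp
  have p: "ortho_below {0<..} (laguerre_weight (a + 1)) n ?p"
    using monic_ortho_eq_iff[OF w] by blast
  have c: "?c \<noteq> 0" by (rule lower_factor_nonzero[OF a])
  have "weight_inner {0<..} (laguerre_weight a) (?p \<bullet>\<^sub>d lower_op a) q = 0" if "degree q < n" for q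
  proof -
    have "weight_inner {0<..} (laguerre_weight a) q (?p \<bullet>\<^sub>d lower_op a)
        = cnj (weight_inner {0<..} (laguerre_weight (a + 1)) ?p (q \<bullet>\<^sub>d raise_op))"
      by (simp add: weight_inner_cnj raise_lower_adjoint[OF a])
    also have "\<dots> = 0" using p that by (simp add: ortho_below_def degree_raise_op)
    finally show ?thesis by (metis weight_inner_cnj complex_cnj_zero)
  qed
  then have "ortho_below {0<..} (laguerre_weight a) n (smult (inverse ?c) (?p \<bullet>\<^sub>d lower_op a))"
    using p c unfolding ortho_below_def
    by (auto simp add: degree_lower_op[OF a] coeff_lower_op weight_inner_smult_left del: of_real_add)
  then have "smult (inverse ?c) (?p \<bullet>\<^sub>d lower_op a) = laguerre_poly a n"
    using monic_ortho_eq_iff[OF scalar_weight_laguerre[OF a]] by metis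
  then show ?thesis using c by (metis smult_smult right_inverse smult_1_left)
qed

lemma laguerre_intertwines:
  assumes "a > -1"
  shows "\<exists>V N. intertwines {0<..} (laguerre_weight a) (laguerre_weight (a + real k)) V \<and>
               intertwines {0<..} (laguerre_weight (a + real k)) (laguerre_weight a) N"
proof (induction k)
  case 0
  show ?case using intertwines_one by auto
next
  case (Suc k)
  let ?b = "a + real k"
  have b: "?b > -1" using assms by simp
  have "p \<bullet>\<^sub>d raise_op \<noteq> 0" "p \<bullet>\<^sub>d lower_op ?b \<noteq> 0" if "p \<noteq> 0" for p
  proof -
    have "coeff (p \<bullet>\<^sub>d raise_op) (degree p) \<noteq> 0" "coeff (p \<bullet>\<^sub>d lower_op ?b) (degree p) \<noteq> 0"
      using that lower_factor_nonzero[OF b, of "degree p"]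
      by (simp_all add: coeff_raise_op coeff_lower_op coeff_eq_0 del: of_real_add)
    then show "p \<bullet>\<^sub>d raise_op \<noteq> 0" "p \<bullet>\<^sub>d lower_op ?b \<noteq> 0" by auto
  qed
  then have "intertwines {0<..} (laguerre_weight ?b) (laguerre_weight (?b + 1)) raise_op"
    "intertwines {0<..} (laguerre_weight (?b + 1)) (laguerre_weight ?b) (lower_op ?b)"
    using laguerre_raise[OF b] laguerre_lower[OF b] degree_lower_op[OF b] degree_raise_op
    by (auto simp: intertwines_def degree_preserving_def intro: exI[of _ 1])
  moreover have "?b + 1 = a + real (Suc k)" by simp
  ultimately show ?case using Suc intertwines_mult by metis
qed

lemma darboux_laguerre_if_int:
  assumes "a > -1" "b > -1" "a - b \<in> \<int>"
  shows "darboux_transformation {0<..} (laguerre_weight b) (laguerre_weight a)"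
proof -
  have "\<exists>V N. intertwines {0<..} (laguerre_weight b) (laguerre_weight a) V \<and>
              intertwines {0<..} (laguerre_weight a) (laguerre_weight b) N"
  proof (cases "a \<ge> b")
    case True
    then obtain k :: nat where "a - b = real k"
      using assms(3) by (metis Ints_cases diff_ge_0_iff_ge of_int_0_le_iff zero_le_imp_eq_int of_int_of_nat_eq)
    then have "a = b + real k" by simp
    then show ?thesis using laguerre_intertwines[OF assms(2)] by blast
  next
    case False
    then have "b - a \<in> \<int>" "b - a \<ge> 0" using Ints_minus[OF assms(3)] by auto
    then obtain k :: nat where "b - a = real k"
      by (metis Ints_cases of_int_0_le_iff zero_le_imp_eq_int of_int_of_nat_eq)
    then have "b = a + real k" by simp
    then show ?thesis using laguerre_intertwines[OF assms(1)] by blast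
  qed
  then show ?thesis
    using darboux_transformationI scalar_weight_laguerre assms by blast
qed

section \<open>Coefficients of the Laguerre polynomials\<close>

text \<open>
  Raising and then lowering returns a multiple of \<open>laguerre_poly a n\<close>. This eigenvalue equation is
  Laguerre's differential equation, here read off coefficientwise.
\<close>

lemma laguerre_coeff_Suc:
  assumes a: "a > -1"
  shows "of_nat (Suc k) * of_real (a + 1 + real k) * coeff (laguerre_poly a n) (Suc k)
       = (of_nat k - of_nat n) * coeff (laguerre_poly a n) k"
proof -
  let ?p = "laguerre_poly a n"
  have "coeff (?p \<bullet>\<^sub>d raise_op \<bullet>\<^sub>d lower_op a) k = of_real (a + 1 + real n) * coeff ?p k"
    by (simp only: laguerre_raise[OF a] laguerre_lower[OF a] coeff_smult)
  then show ?thesis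
    by (simp add: coeff_lower_op coeff_raise_op algebra_simps)
qed

text \<open>
  Iterating the recurrence from the constant coefficient upwards. Multiplied by \<open>j!\<close>, the coefficient
  becomes the \<open>j\<close>-th derivative at 0, which thus depends on \<open>n\<close> only through \<open>coeff (laguerre_poly a n) 0\<close>
  and the polynomial \<open>pochhammer (- n) j\<close>.
\<close>

lemma laguerre_coeff:
  assumes a: "a > -1"
  shows "fact j * pochhammer (of_real (a + 1)) j * coeff (laguerre_poly a n) j
       = pochhammer (- of_nat n) j * coeff (laguerre_poly a n) 0"
proof (induction j)
  case (Suc j)
  let ?p = "laguerre_poly a n"
  have "fact (Suc j) * pochhammer (complex_of_real (a + 1)) (Suc j) * coeff ?p (Suc j)
      = fact j * pochhammer (of_real (a + 1)) j
        * (of_nat (Suc j) * of_real (a + 1 + real j) * coeff ?p (Suc j))"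
    by (simp add: pochhammer_Suc algebra_simps)
  also have "\<dots> = (- of_nat n + of_nat j) * (fact j * pochhammer (of_real (a + 1)) j * coeff ?p j)"
    unfolding laguerre_coeff_Suc[OF a] by (simp add: algebra_simps)
  also have "\<dots> = pochhammer (- of_nat n) (Suc j) * coeff ?p 0"
    unfolding Suc.IH by (simp add: pochhammer_Suc algebra_simps)
  finally show ?case .
qed simp

lemma pochhammer_of_real_nonzero:
  assumes "c > 0"
  shows "pochhammer (complex_of_real c) j \<noteq> 0"
  using pochhammer_pos[OF assms, of j] by (simp add: pochhammer_of_real)

lemma laguerre_monic:
  assumes "a > -1"
  shows "degree (laguerre_poly a n) = n" "coeff (laguerre_poly a n) n = 1"
proof -
  have "ortho_below {0<..} (laguerre_weight a) n (laguerre_poly a n)"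
    using monic_ortho_eq_iff[OF scalar_weight_laguerre[OF assms]] by blast
  then show "degree (laguerre_poly a n) = n" "coeff (laguerre_poly a n) n = 1"
    unfolding ortho_below_def by metis+
qed

text \<open>
  The coefficient of \<open>x^n\<close> is 1, so \<open>laguerre_coeff\<close> for \<open>j = n\<close> determines the constant one.
\<close>

lemma laguerre_coeff_0:
  assumes a: "a > -1"
  shows "coeff (laguerre_poly a n) 0 = (-1) ^ n * pochhammer (of_real (a + 1)) n"
proof -
  have "fact n * pochhammer (of_real (a + 1)) n = (-1) ^ n * fact n * coeff (laguerre_poly a n) 0"
    using laguerre_coeff[OF a, of n n] by (simp add: laguerre_monic[OF a] pochhammer_same del: of_real_add)
  then have "fact n * pochhammer (of_real (a + 1)) n = fact n * ((-1) ^ n * coeff (laguerre_poly a n) 0)"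
    by (simp only: mult_ac)
  then have "pochhammer (of_real (a + 1)) n = (-1) ^ n * coeff (laguerre_poly a n) 0"
    by (simp only: mult_cancel_left fact_nonzero simp_thms)
  then show ?thesis by (metis left_minus_one_mult_self)
qed

section \<open>The constant and the leading coefficient of an image\<close>

lemma poly_pochhammer: "poly (pochhammer p j) x = pochhammer (poly p x) j"
  by (simp add: pochhammer_prod poly_prod)

text \<open>
  As functions of \<open>n\<close>, both are polynomials: the factor \<open>pochhammer [:0, -1:] j\<close> takes the value \<open>(-n)(-n+1)\<dots>(-n+j-1)\<close>,
  which is \<open>(-1)^j n(n-1)\<dots>(n-j+1)\<close>. The first symbol describes how the value at 0 of
  \<open>laguerre_poly a n\<close> changes under \<open>V\<close>, and the second one the leading coefficient of the image of a
  monic polynomial of degree \<open>n\<close>.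
\<close>

definition value_at_0_symbol :: "real \<Rightarrow> diff_op \<Rightarrow> complex poly" where
  "value_at_0_symbol a V =
     (\<Sum>j\<le>degree V. smult (coeff (coeff V j) 0 / pochhammer (of_real (a + 1)) j)
        (pochhammer [:0, -1:] j))"

definition leading_symbol :: "diff_op \<Rightarrow> complex poly" where
  "leading_symbol V =
     (\<Sum>j\<le>degree V. smult ((-1) ^ j * coeff (coeff V j) j) (pochhammer [:0, -1:] j))"

text \<open>
  The constant coefficient of \<open>p^(j) f\<close> is \<open>j! coeff p j\<close> times \<open>f(0)\<close>, and by \<open>laguerre_coeff\<close> the
  first factor is a polynomial in \<open>n\<close> times \<open>coeff p 0\<close>.
\<close>

lemma coeff_0_laguerre_act:
  assumes a: "a > -1"
  shows "coeff (laguerre_poly a n \<bullet>\<^sub>d V) 0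
       = coeff (laguerre_poly a n) 0 * poly (value_at_0_symbol a V) (of_nat n)"
proof -
  let ?p = "laguerre_poly a n" and ?c = "pochhammer (complex_of_real (a + 1))"
  have c: "?c j \<noteq> 0" for j using a by (intro pochhammer_of_real_nonzero) simp
  have *: "coeff ((pderiv ^^ j) ?p) 0 = coeff ?p 0 * (pochhammer (- of_nat n) j / ?c j)" for j
    using laguerre_coeff[OF a, of j n] c[of j]
    by (simp add: coeff_higher_pderiv pochhammer_fact[symmetric] field_simps del: of_real_add)
  show ?thesis
    unfolding dop_act_def value_at_0_symbol_def coeff_sum poly_sum sum_distrib_left
    by (intro sum.cong refl) (simp add: coeff_mult * poly_pochhammer mult_ac)
qed

text \<open>
  Terms of lower degree in \<open>p\<close> have images of lower degree, so only the image of \<open>x^n\<close> counts. In it,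
  the coefficient of \<open>x^n\<close> in \<open>x^(n-j) f\<close> is that of \<open>x^j\<close> in \<open>f\<close>. For \<open>j > n\<close> the derivative vanishes,
  and so does \<open>pochhammer (- n) j\<close>; therefore a single polynomial in \<open>n\<close> covers all cases.
\<close>

lemma coeff_degree_act:
  assumes V: "degree_preserving V" and p: "degree p = n" "coeff p n = 1"
  shows "coeff (p \<bullet>\<^sub>d V) n = poly (leading_symbol V) (of_nat n)"
proof -
  define r where "r = p - monom 1 n"
  have split: "p = monom 1 n + r" by (simp add: r_def)
  have "coeff (r \<bullet>\<^sub>d V) n = 0"
  proof (cases "r = 0")
    case True
    then show ?thesis by (simp add: dop_act_def)
  next
    case False
    have "degree r \<le> n" unfolding r_def using p by (intro degree_diff_le) (auto simp: degree_monom_le)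
    moreover have "coeff r n = 0" using p by (simp add: r_def)
    ultimately have "degree r < n" using False by (metis le_less leading_coeff_0_iff)
    then show ?thesis using V False by (simp add: degree_preserving_def coeff_eq_0)
  qed
  moreover have "coeff ((pderiv ^^ j) (monom 1 n) * f) n
      = (-1) ^ j * coeff f j * pochhammer (- of_nat n) j" for j and f :: "complex poly"
  proof (cases "j \<le> n")
    case True
    have "pochhammer (of_nat (Suc (n - j))) j = (-1) ^ j * pochhammer (- of_nat n :: complex) j"
      using True unfolding pochhammer_minus[of "of_nat n" j]
      by (simp add: of_nat_diff add.commute)
    moreover have "(pderiv ^^ j) (monom 1 n) = monom (pochhammer (of_nat (Suc (n - j))) j :: complex) (n - j)"
      using True by (intro poly_eqI) (auto simp: coeff_higher_pderiv)
    ultimately show ?thesis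
      using True by (simp only: coeff_monom_mult) simp
  next
    case False
    then have "(pderiv ^^ j) (monom 1 n :: complex poly) = 0"
      by (intro poly_eqI) (auto simp: coeff_higher_pderiv)
    then show ?thesis using False by (simp add: pochhammer_of_nat_eq_0_iff)
  qed
  ultimately show ?thesis
    unfolding split dop_act_add_left coeff_add
    unfolding dop_act_def leading_symbol_def coeff_sum poly_sum
    by (simp add: poly_pochhammer)
qed

section \<open>Quotients of Gamma functions that are rational\<close>

text \<open>
  Dividing by the power reverses the coefficients and evaluates at \<open>1/n\<close>, which tends to 0.
\<close>

lemma poly_of_nat_asymp:
  fixes p :: "complex poly"
  shows "(\<lambda>n. poly p (of_nat n) / of_nat n ^ degree p) \<longlonglongrightarrow> lead_coeff p"
proof -
  have "(\<lambda>n. poly (reflect_poly p) (inverse (of_nat n))) \<longlonglongrightarrow> poly (reflect_poly p) 0"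
    by (intro tendsto_intros lim_inverse_n)
  moreover have "\<forall>\<^sub>F n in sequentially. poly (reflect_poly p) (inverse (of_nat n))
      = poly p (of_nat n) / of_nat n ^ degree p"
    using eventually_gt_at_top[of 0]
  proof eventually_elim
    case (elim n)
    then have "inverse (complex_of_nat n) \<noteq> 0" by simp
    from poly_reflect_poly_nz[OF this, of p] show ?case
      by (simp only: inverse_inverse_eq power_inverse divide_inverse mult.commute)
  qed
  ultimately show ?thesis
    unfolding poly_reflect_poly_0 by (rule Lim_transform_eventually)
qed

text \<open>
  By Gauss's limit formula \<open>pochhammer d n / pochhammer c n\<close> is asymptotic to
  \<open>(\<Gamma>(c)/\<Gamma>(d)) n^(d-c)\<close>. It equals \<open>Q(n)/A(n)\<close>, which has the order \<open>n^(deg Q - deg A)\<close>. So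
  \<open>n^e\<close> has a finite nonzero limit, where \<open>e\<close> is the difference of the exponents, and hence \<open>e = 0\<close>.
\<close>

lemma pochhammer_ratio_rational_imp_int:
  fixes Q A :: "complex poly"
  assumes c: "c > 0" and d: "d > 0"
    and A: "\<And>n. poly A (of_nat n) \<noteq> 0"
    and eq: "\<And>n. pochhammer (of_real c) n * poly Q (of_nat n)
               = pochhammer (of_real d) n * poly A (of_nat n)"
  shows "d - c \<in> \<int>"
proof -
  define e where "e = c - d + real (degree Q) - real (degree A)"
  let ?q = "\<lambda>n. norm (poly Q (of_nat n) / of_nat n ^ degree Q)"
  let ?a = "\<lambda>n. norm (poly A (of_nat n) / of_nat n ^ degree A)"
  have "Q \<noteq> 0"
    using eq[of 0] A[of 0] by auto
  have "A \<noteq> 0"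
    using A[of 0] by auto
  have "(\<lambda>n. Gamma_series' c n / Gamma_series' d n * (?a n / ?q n))
      \<longlonglongrightarrow> Gamma c / Gamma d * (norm (lead_coeff A) / norm (lead_coeff Q))"
    using \<open>Q \<noteq> 0\<close> Gamma_real_pos[OF d]
    by (intro tendsto_intros Gamma_series'_LIMSEQ poly_of_nat_asymp) auto
  moreover have "\<forall>\<^sub>F n in sequentially.
      Gamma_series' c n / Gamma_series' d n * (?a n / ?q n) = real n powr e"
    using eventually_gt_at_top[of 0]
  proof eventually_elim
    case (elim n)
    have pos: "pochhammer c n > 0" "pochhammer d n > 0"
      using c d by (auto intro: pochhammer_pos)
    have "norm (pochhammer (complex_of_real c) n * poly Q (of_nat n))
        = norm (pochhammer (complex_of_real d) n * poly A (of_nat n))"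
      by (simp only: eq)
    then have "pochhammer c n * norm (poly Q (of_nat n)) = pochhammer d n * norm (poly A (of_nat n))"
      using pos by (simp add: norm_mult pochhammer_of_real)
    moreover from this have "norm (poly Q (of_nat n)) \<noteq> 0"
      using A[of n] pos by auto
    ultimately have u: "norm (poly A (of_nat n)) / norm (poly Q (of_nat n))
        = pochhammer c n / pochhammer d n"
      using pos by (subst frac_eq_eq) (auto simp: mult.commute)
    have "?a n / ?q n = norm (poly A (of_nat n)) / norm (poly Q (of_nat n))
        * (real n ^ degree Q / real n ^ degree A)"
      by (simp add: norm_divide norm_power)
    then have r: "?a n / ?q n
        = pochhammer c n / pochhammer d n * (real n ^ degree Q / real n ^ degree A)"
      unfolding u .
    have g: "Gamma_series' c n / Gamma_series' d n = real n powr (c - d) * (pochhammer d n / pochhammer c n)"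
      using elim by (simp add: Gamma_series'_def powr_def exp_diff left_diff_distrib)
    have "real n powr e = real n powr (c - d) * (real n ^ degree Q / real n ^ degree A)"
      using elim by (simp add: e_def powr_add powr_diff powr_realpow)
    then show ?case unfolding r g using pos by simp
  qed
  ultimately have lim: "(\<lambda>n. real n powr e)
      \<longlonglongrightarrow> Gamma c / Gamma d * (norm (lead_coeff A) / norm (lead_coeff Q))" (is "_ \<longlonglongrightarrow> ?L")
    by (rule Lim_transform_eventually)
  have L: "?L > 0"
    using Gamma_real_pos[OF c] Gamma_real_pos[OF d] \<open>Q \<noteq> 0\<close> \<open>A \<noteq> 0\<close> by simp
  have "e = 0"
  proof (rule linorder_cases[of e 0])
    assume "e < 0"
    then have "(\<lambda>n. real n powr e) \<longlonglongrightarrow> 0"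
      by (intro tendsto_neg_powr filterlim_real_sequentially)
    then show ?thesis using LIMSEQ_unique[OF lim] L by auto
  next
    assume "e > 0"
    then have "(\<lambda>n. real n powr (-e)) \<longlonglongrightarrow> 0"
      by (intro tendsto_neg_powr filterlim_real_sequentially) auto
    moreover have "(\<lambda>n. real n powr (-e)) \<longlonglongrightarrow> inverse ?L"
      unfolding powr_minus by (rule tendsto_inverse[OF lim less_imp_neq[OF L, symmetric]])
    ultimately show ?thesis using LIMSEQ_unique L by fastforce
  qed simp
  then have "d - c = of_int (int (degree Q) - int (degree A))" by (simp add: e_def)
  then show ?thesis by (metis Ints_of_int)
qed

section \<open>Darboux transformations of Laguerre weights\<close>

text \<open>
  The operator \<open>V\<close> alone forces integrality: the leading coefficients give \<open>A n\<close> as a polynomial in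
  \<open>n\<close>, and the constant coefficients compare the two Pochhammer symbols.
\<close>

lemma darboux_laguerre_imp_int:
  assumes a: "a > -1" and b: "b > -1"
    and "darboux_transformation {0<..} (laguerre_weight b) (laguerre_weight a)"
  shows "a - b \<in> \<int>"
proof -
  obtain V where V: "degree_preserving V"
    and "\<And>n. \<exists>A. laguerre_poly b n \<bullet>\<^sub>d V = smult A (laguerre_poly a n)"
    using assms(3) unfolding darboux_transformation_def by blast
  then obtain A where A: "\<And>n. laguerre_poly b n \<bullet>\<^sub>d V = smult (A n) (laguerre_poly a n)" by metis
  have A_poly: "A n = poly (leading_symbol V) (of_nat n)" for n
    using coeff_degree_act[OF V laguerre_monic[OF b], of n]
    by (simp add: A laguerre_monic[OF a])
  have A_nz: "A n \<noteq> 0" for n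
  proof -
    have "laguerre_poly b n \<noteq> 0" using laguerre_monic(2)[OF b, of n] by auto
    then have "smult (A n) (laguerre_poly a n) \<noteq> 0"
      using V A[of n] unfolding degree_preserving_def by metis
    then show ?thesis by auto
  qed
  have "pochhammer (of_real (b + 1)) n * poly (value_at_0_symbol b V) (of_nat n)
      = pochhammer (of_real (a + 1)) n * poly (leading_symbol V) (of_nat n)" for n
  proof -
    have "(-1) ^ n * (pochhammer (of_real (b + 1)) n * poly (value_at_0_symbol b V) (of_nat n))
        = (-1) ^ n * (pochhammer (of_real (a + 1)) n * poly (leading_symbol V) (of_nat n))"
      using coeff_0_laguerre_act[OF b, of n V]
      by (simp add: A laguerre_coeff_0[OF a] laguerre_coeff_0[OF b] A_poly mult_ac del: of_real_add)
    then show ?thesis by simp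
  qed
  then have "(a + 1) - (b + 1) \<in> \<int>"
    using a b A_nz
    by (intro pochhammer_ratio_rational_imp_int
          [where Q = "value_at_0_symbol b V" and A = "leading_symbol V"]) (simp_all flip: A_poly)
  then show ?thesis by simp
qed

theorem theorem5p1:
  fixes \<alpha> \<beta> :: real
  assumes "\<alpha> > -1" and "\<beta> > -1"
  shows "darboux_transformation {0<..} (laguerre_weight \<beta>) (laguerre_weight \<alpha>) \<longleftrightarrow> \<alpha> - \<beta> \<in> \<int>"
  using darboux_laguerre_imp_int[OF assms] darboux_laguerre_if_int[OF assms] by blast

end
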